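(* Let $\mathbf{k}$ be a commutative ring in which $2$ is invertible. Then the family $(\eta_\alpha)_{n\in\mathbb{N},\ \alpha\in\operatorname{Comp}(n)}$ of enriched monomial functions is a basis of the $\mathbf{k}$-module $\operatorname{QSym}$.
   Context: $\mathbb{N}=\{0,1,2,\ldots\}$, $[n]=\{1,\ldots,n\}$ (empty if $n\le 0$). A composition of $n\in\mathbb{N}$ is a finite sequence $\alpha=(\alpha_1,\ldots,\alpha_p)$ of positive integers with sum $n$; its length is $\ell(\alpha)=p$. $\operatorname{Comp}(n)$ is the set of compositions of $n$ (for $n=0$, only the empty composition). For $\alpha\in\operatorname{Comp}(n)$, $\operatorname{Des}(\alpha)=\{\alpha_1,\alpha_1+\alpha_2,\ldots,\alpha_1+\cdots+\alpha_{p-1}\}\subseteq[n-1]$. $\operatorname{QSym}$ is the ring of quasisymmetric functions over $\mathbf{k}$: the $\mathbf{k}$-subalgebra of $\mathbf{k}[[x_1,x_2,x_3,\ldots]]$ consisting of the bounded-degree power series in which, for all non-negative integers $\alpha_1,\ldots,\alpha_p$ and all $i_1<\cdots<i_p$, the coefficients of $x_1^{\alpha_1}\cdots x_p^{\alpha_p}$ and $x_{i_1}^{\alpha_1}\cdots x_{i_p}^{\alpha_p}$ are equal. For a composition $\alpha$, the monomial quasisymmetric function is $M_\alpha=\sum_{i_1<\cdots<i_p}x_{i_1}^{\alpha_1}\cdots x_{i_p}^{\alpha_p}$ (indices are positive integers); the $M_\alpha$ form a basis of the $\mathbf{k}$-module $\operatorname{QSym}$. For $\alpha\in\operatorname{Comp}(n)$,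 the enriched monomial function is $\eta_\alpha=\sum_{\beta\in\operatorname{Comp}(n),\ \operatorname{Des}(\beta)\subseteq\operatorname{Des}(\alpha)}2^{\ell(\beta)}M_\beta$. *)

theory Defs
  imports Main "HOL-Library.Poly_Mapping"
begin

text \<open>
  The base ring is a type of sort \<open>{comm_ring, comm_monoid_mult, numeral}\<close>, that is, a commutative
  ring with unity in which \<open>0 = 1\<close> is permitted. Every \<open>comm_ring_1\<close> type with \<open>numeral\<close> has this
  sort; \<open>comm_ring_1\<close> itself would exclude the zero ring, and so would the locale
  \<open>module\<close> of \<open>HOL.Modules\<close>.

  A monomial is a finitely supported exponent function of type \<open>nat \<Rightarrow>\<^sub>0 nat\<close>, and a power series
  in countably many variables is the function taking each monomial to its coefficient.
  Variables are numbered from 0: the index \<open>i\<close> stands for the variable usually called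
  \<open>x\<^bsub>i+1\<^esub>\<close>.
\<close>

type_synonym mono = "nat \<Rightarrow>\<^sub>0 nat"
type_synonym 'k pseries = "mono \<Rightarrow> 'k"

subsection \<open>Bases of submodules of a module of functions\<close>

text \<open>The \<open>'k\<close>-module structure on functions \<open>'m \<Rightarrow> 'k\<close> is the pointwise one.\<close>

definition lin_indep_family ::
  "'i set \<Rightarrow> ('i \<Rightarrow> 'm \<Rightarrow> 'k::{comm_ring, comm_monoid_mult}) \<Rightarrow> bool" where
  "lin_indep_family I b \<longleftrightarrow>
     (\<forall>J c. finite J \<longrightarrow> J \<subseteq> I \<longrightarrow> (\<lambda>m. \<Sum>i\<in>J. c i * b i m) = (\<lambda>m. 0) \<longrightarrow> (\<forall>i\<in>J. c i = 0))"

definition span_family ::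
  "'i set \<Rightarrow> ('i \<Rightarrow> 'm \<Rightarrow> 'k::{comm_ring, comm_monoid_mult}) \<Rightarrow> ('m \<Rightarrow> 'k) set" where
  "span_family I b = {(\<lambda>m. \<Sum>i\<in>J. c i * b i m) | J c. finite J \<and> J \<subseteq> I}"

definition basis_family ::
  "'i set \<Rightarrow> ('i \<Rightarrow> 'm \<Rightarrow> 'k::{comm_ring, comm_monoid_mult}) \<Rightarrow> ('m \<Rightarrow> 'k) set \<Rightarrow> bool" where
  "basis_family I b V \<longleftrightarrow> lin_indep_family I b \<and> span_family I b = V"

subsection \<open>Compositions\<close>

definition Comp :: "nat \<Rightarrow> nat list set" where
  "Comp n = {\<alpha>. (\<forall>a\<in>set \<alpha>. 0 < a) \<and> sum_list \<alpha> = n}"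

definition Des :: "nat list \<Rightarrow> nat set" where
  "Des \<alpha> = {sum_list (take j \<alpha>) | j. 1 \<le> j \<and> j < length \<alpha>}"

lemma finite_Comp: "finite (Comp n)"
proof (rule finite_subset)
  have "length \<alpha> \<le> sum_list \<alpha>" if "\<forall>a\<in>set \<alpha>. 0 < a" for \<alpha> :: "nat list"
    using that by (induction \<alpha>) auto
  then show "Comp n \<subseteq> {\<alpha>. set \<alpha> \<subseteq> {..n} \<and> length \<alpha> \<le> n}"
    by (auto simp: Comp_def member_le_sum_list)
qed (simp add: finite_lists_length_le)

subsection \<open>Quasisymmetric functions\<close>

text \<open>\<open>mono_of [i\<^sub>1,\<dots>,i\<^sub>p] [a\<^sub>1,\<dots>,a\<^sub>p]\<close> is the product of the \<open>a\<^sub>j\<close>-th powers of the variables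
  \<open>i\<^sub>j\<close>; monomials are written additively.\<close>

definition mono_of :: "nat list \<Rightarrow> nat list \<Rightarrow> mono" where
  "mono_of is \<alpha> = sum_list (map2 Poly_Mapping.single is \<alpha>)"

definition mono_deg :: "mono \<Rightarrow> nat" where
  "mono_deg m = (\<Sum>i\<in>Poly_Mapping.keys m. Poly_Mapping.lookup m i)"

definition QSym :: "'k::{comm_ring, comm_monoid_mult} pseries set" where
  "QSym = {f. (\<exists>d. \<forall>m. f m \<noteq> 0 \<longrightarrow> mono_deg m \<le> d) \<and>
     (\<forall>\<alpha> is. length is = length \<alpha> \<longrightarrow> sorted_wrt (<) is \<longrightarrow>
        f (mono_of [0..<length \<alpha>] \<alpha>) = f (mono_of is \<alpha>))}"

lemma QSym_zero: "(\<lambda>m. 0) \<in> QSym"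
  by (simp add: QSym_def)

lemma QSym_add: "(\<lambda>m. f m + g m) \<in> QSym" if fg: "f \<in> QSym" "g \<in> QSym"
proof -
  obtain d e where "\<forall>m. f m \<noteq> 0 \<longrightarrow> mono_deg m \<le> d" "\<forall>m. g m \<noteq> 0 \<longrightarrow> mono_deg m \<le> e"
    using fg by (auto simp: QSym_def)
  then have "\<forall>m. f m + g m \<noteq> 0 \<longrightarrow> mono_deg m \<le> max d e"
    by (metis add_0 le_max_iff_disj)
  then have "\<exists>D. \<forall>m. f m + g m \<noteq> 0 \<longrightarrow> mono_deg m \<le> D" ..
  then show ?thesis
    using fg unfolding QSym_def by simp
qed

lemma QSym_scale: "(\<lambda>m. c * f m) \<in> QSym" if "f \<in> QSym"
  using that by (auto simp: QSym_def) (metis mult_zero_right)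

text \<open>The coefficient of \<open>m\<close> in the formal sum of all \<open>mono_of is \<alpha>\<close> counts the index sequences
  \<open>is\<close> that give \<open>m\<close>. There are finitely many when \<open>\<alpha>\<close> has positive entries, the only case in
  which \<open>M \<alpha>\<close> is used.\<close>

definition M :: "nat list \<Rightarrow> 'k::{comm_ring, comm_monoid_mult} pseries" where
  "M \<alpha> = (\<lambda>m. \<Sum>is | length is = length \<alpha> \<and> sorted_wrt (<) is \<and> mono_of is \<alpha> = m. 1)"

lemma keys_mono_of:
  assumes "length is = length \<alpha>" "\<forall>a\<in>set \<alpha>. 0 < a"
  shows "Poly_Mapping.keys (mono_of is \<alpha>) = set is"
  using assms
proof (induction "is" \<alpha> rule: list_induct2)
  case Nil
  then show ?case by (simp add: mono_of_def)
next
  case (Cons i js a \<alpha>)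
  have "Poly_Mapping.keys (p + q) = Poly_Mapping.keys p \<union> Poly_Mapping.keys q" for p q :: mono
    by (auto simp: in_keys_iff lookup_add)
  with Cons show ?case by (simp add: mono_of_def)
qed

lemma finite_index_lists:
  assumes "\<forall>a\<in>set \<alpha>. 0 < a"
  shows "finite {is. length is = length \<alpha> \<and> sorted_wrt (<) is \<and> mono_of is \<alpha> = m}"
proof (rule finite_subset)
  show "{is. length is = length \<alpha> \<and> sorted_wrt (<) is \<and> mono_of is \<alpha> = m}
    \<subseteq> {is. set is \<subseteq> Poly_Mapping.keys m \<and> length is = length \<alpha>}"
    using assms by (auto simp: keys_mono_of)
qed (simp add: finite_lists_length_eq)

definition \<eta> :: "nat list \<Rightarrow> 'k::{comm_ring, comm_monoid_mult, numeral} pseries" where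
  "\<eta> \<alpha> = (\<lambda>m. \<Sum>\<beta> | \<beta> \<in> Comp (sum_list \<alpha>) \<and> Des \<beta> \<subseteq> Des \<alpha>. 2 ^ length \<beta> * M \<beta> m)"

end

theory Submission
  imports Defs
begin

text \<open>
  The coefficient of a monomial in a quasisymmetric function depends only on the composition of
  its nonzero exponents, so quasisymmetric functions are functions on compositions that vanish in
  large degree, and \<open>M \<beta>\<close> is the indicator of \<open>\<beta>\<close>. On \<open>Comp n\<close>, ordered by inclusion
  of \<open>Des\<close>, the passage from \<open>M\<close> to \<open>\<eta>\<close> is triangular with the powers \<open>2 ^ length \<beta>\<close>
  on the diagonal, and these are units.
\<close>

subsection \<open>Descent sets\<close>

lemma finite_Des: "finite (Des \<alpha>)"
  unfolding Des_def by simp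

lemma Des_Nil: "Des [] = {}"
  by (auto simp: Des_def)

text \<open>The partial sums after the first part are those of the tail shifted by \<open>a\<close>;
  for an empty tail \<open>a\<close> is the total, which \<open>Des\<close> leaves out.\<close>

lemma Des_Cons: "Des (a # \<alpha>) = (if \<alpha> = [] then {} else insert a ((+) a ` Des \<alpha>))"
proof (cases "\<alpha> = []")
  case True
  then show ?thesis by (auto simp: Des_def)
next
  case False
  have "Des (a # \<alpha>) = (\<lambda>j. sum_list (take j (a # \<alpha>))) ` {1..<length (a # \<alpha>)}"
    by (auto simp: Des_def)
  \<comment> \<open>The extra index \<open>0\<close> is the empty prefix of the tail and produces
    the element \<open>a\<close>.\<close>
  also have "{1..<length (a # \<alpha>)} = Suc ` insert 0 {1..<length \<alpha>}"
    using False by (auto simp: image_Suc_atLeastLessThan simp flip: length_greater_0_conv)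
  also have "(\<lambda>j. sum_list (take j (a # \<alpha>))) ` \<dots> =
      insert a ((+) a ` (\<lambda>j. sum_list (take j \<alpha>)) ` {1..<length \<alpha>})"
    by (simp add: image_image del: image_Suc_atLeastLessThan)
  also have "(\<lambda>j. sum_list (take j \<alpha>)) ` {1..<length \<alpha>} = Des \<alpha>"
    by (auto simp: Des_def)
  finally show ?thesis using False by simp
qed

lemma Des_pos:
  assumes "\<forall>a\<in>set \<alpha>. 0 < a" "x \<in> Des \<alpha>"
  shows "0 < x"
  using assms by (cases \<alpha>) (auto simp: Des_Nil Des_Cons split: if_splits)

text \<open>The least descent is the first part. Removing it and shifting back gives the descent set
  of the tail; the total supplies the last part, which \<open>Des\<close> does not record.\<close>

lemma Des_eq_imp_eq:
  assumes "\<forall>a\<in>set \<alpha>. 0 < a" "\<forall>b\<in>set \<beta>. 0 < b"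
    and "sum_list \<alpha> = sum_list \<beta>" "Des \<alpha> = Des \<beta>"
  shows "\<alpha> = \<beta>"
  using assms
proof (induction \<alpha> arbitrary: \<beta>)
  case Nil
  then show ?case by (cases \<beta>) auto
next
  case (Cons a \<alpha>)
  then obtain b \<beta>' where \<beta>: "\<beta> = b # \<beta>'" by (cases \<beta>) auto
  show ?case
  proof (cases "\<alpha> = [] \<or> \<beta>' = []")
    case True
    moreover have "Des (c # \<gamma>) = {} \<longleftrightarrow> \<gamma> = []" for c \<gamma>
      by (simp add: Des_Cons)
    ultimately have "\<alpha> = [] \<and> \<beta>' = []"
      using Cons.prems(4) unfolding \<beta> by metis
    then show ?thesis using Cons.prems(3) \<beta> by simp
  next
    case False
    have Min: "Min (Des (c # \<gamma>)) = c" if "\<gamma> \<noteq> []" for c \<gamma>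
      using that by (auto simp: Des_Cons finite_Des intro!: Min_eqI)
    have "a = b" using Min[of \<alpha> a] Min[of \<beta>' b] False Cons.prems(4) \<beta> by simp
    \<comment> \<open>Positive parts keep \<open>0\<close> out of \<open>Des \<gamma>\<close>, so
      the inserted first part is a new element and can be cancelled from both sides.\<close>
    have notin: "c \<notin> (+) c ` Des \<gamma>" if "\<forall>x\<in>set \<gamma>. 0 < x" for c and \<gamma> :: "nat list"
      using Des_pos[OF that] by fastforce
    have "insert a ((+) a ` Des \<alpha>) = insert a ((+) a ` Des \<beta>')"
      using Cons.prems(4) False by (simp add: \<beta> \<open>a = b\<close> Des_Cons)
    moreover have "a \<notin> (+) a ` Des \<alpha>" "a \<notin> (+) a ` Des \<beta>'"
      using Cons.prems(1,2) \<beta> by (simp_all add: notin)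
    ultimately have "(+) a ` Des \<alpha> = (+) a ` Des \<beta>'" by (simp add: insert_ident)
    then have "Des \<alpha> = Des \<beta>'" by (simp add: inj_image_eq_iff)
    moreover have "sum_list \<alpha> = sum_list \<beta>'"
      using Cons.prems(3) \<beta> \<open>a = b\<close> by simp
    ultimately have "\<alpha> = \<beta>'"
      using Cons.prems(1,2) \<beta> by (intro Cons.IH) simp_all
    then show ?thesis using \<beta> \<open>a = b\<close> by simp
  qed
qed

lemma inj_on_Des: "inj_on Des (Comp n)"
  by (rule inj_onI, rule Des_eq_imp_eq) (simp_all add: Comp_def)

subsection \<open>The composition of a monomial\<close>

text \<open>Restricting to \<open>keys\<close> drops zero exponents, so the result is always a
  composition.\<close>

definition comp_of :: "mono \<Rightarrow> nat list" where
  "comp_of m = map (Poly_Mapping.lookup m) (sorted_list_of_set (Poly_Mapping.keys m))"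

lemma length_comp_of: "length (sorted_list_of_set (Poly_Mapping.keys m)) = length (comp_of m)"
  by (simp add: comp_of_def)

lemma lookup_mono_of:
  "distinct is \<Longrightarrow>
    Poly_Mapping.lookup (mono_of is (map g is)) x = (if x \<in> set is then g x else 0)"
  by (induction "is") (auto simp: mono_of_def lookup_add lookup_single when_def)

text \<open>Zero entries are allowed here because the exponent lists in the definition of
  \<open>QSym\<close> may contain them.\<close>

lemma comp_of_mono_of:
  assumes "length is = length \<alpha>" "sorted_wrt (<) is"
  shows "comp_of (mono_of is \<alpha>) = filter (\<lambda>a. a \<noteq> 0) \<alpha>"
proof -
  have dist: "distinct is" using assms(2) by (simp add: strict_sorted_iff)
  \<comment> \<open>As the indices are distinct, each determines its exponent; filtering exponents
    then becomes filtering indices.\<close>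
  define g where "g x = the (map_of (zip is \<alpha>) x)" for x
  have \<alpha>: "\<alpha> = map g is"
    using assms(1) dist by (intro nth_equalityI) (auto simp: g_def map_of_zip_nth)
  have lk: "Poly_Mapping.lookup (mono_of is \<alpha>) x = (if x \<in> set is then g x else 0)" for x
    unfolding \<alpha> using dist by (rule lookup_mono_of)
  let ?js = "filter (\<lambda>x. g x \<noteq> 0) is"
  have "Poly_Mapping.keys (mono_of is \<alpha>) = set ?js"
    by (auto simp: in_keys_iff lk split: if_splits)
  moreover have "sorted_wrt (<) ?js" using assms(2) by (rule sorted_wrt_filter)
  ultimately have "sorted_list_of_set (Poly_Mapping.keys (mono_of is \<alpha>)) = ?js"
    by (simp only: sorted_list_of_set.idem_if_sorted_distinct strict_sorted_iff)
  then have "comp_of (mono_of is \<alpha>) = map g ?js"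
    by (simp add: comp_of_def lk)
  also have "\<dots> = filter (\<lambda>a. a \<noteq> 0) \<alpha>" by (simp add: \<alpha> filter_map o_def)
  finally show ?thesis .
qed

lemma mono_of_comp_of: "mono_of (sorted_list_of_set (Poly_Mapping.keys m)) (comp_of m) = m"
  by (rule poly_mapping_eqI) (simp add: comp_of_def lookup_mono_of in_keys_iff)

lemma comp_of_in_Comp: "comp_of m \<in> Comp (mono_deg m)"
  by (auto simp: Comp_def comp_of_def mono_deg_def in_keys_iff sum_list_distinct_conv_sum_set)

lemma comp_of_mono_of_upt:
  assumes "\<forall>a\<in>set \<alpha>. 0 < a"
  shows "comp_of (mono_of [0..<length \<alpha>] \<alpha>) = \<alpha>"
  using assms by (simp add: comp_of_mono_of filter_id_conv)

section \<open>Coefficients of \<open>M\<close>, \<eta> and quasisymmetric functions\<close>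

text \<open>With positive exponents the index list must enumerate the keys of \<open>m\<close> in
  increasing order, so the set being counted has at most one element.\<close>

lemma M_eq:
  assumes "\<forall>a\<in>set \<alpha>. 0 < a"
  shows "(M \<alpha> :: 'k::{comm_ring, comm_monoid_mult} pseries) m = (if comp_of m = \<alpha> then 1 else 0)"
proof -
  let ?S = "{is. length is = length \<alpha> \<and> sorted_wrt (<) is \<and> mono_of is \<alpha> = m}"
  let ?ks = "sorted_list_of_set (Poly_Mapping.keys m)"
  have "comp_of m = \<alpha> \<and> is = ?ks" if "is \<in> ?S" for "is"
  proof -
    have "comp_of m = \<alpha>"
      using that assms comp_of_mono_of[of "is" \<alpha>] by (auto simp: filter_id_conv)
    moreover have "Poly_Mapping.keys m = set is"
      using that assms keys_mono_of[of "is" \<alpha>] by auto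
    ultimately show ?thesis using that
      by (simp add: sorted_list_of_set.idem_if_sorted_distinct strict_sorted_iff)
  qed
  moreover have "?ks \<in> ?S" if "comp_of m = \<alpha>"
    using that mono_of_comp_of[of m] by (auto simp: comp_of_def)
  ultimately have S: "?S = (if comp_of m = \<alpha> then {?ks} else {})"
    unfolding if_split[of "\<lambda>T. ?S = T"] by blast
  show ?thesis unfolding M_def S by simp
qed

text \<open>Each monomial occurs in \<open>M \<beta>\<close> for just one composition \<beta>,
  namely \<open>comp_of m\<close>, so the defining sum collapses to at most one term.\<close>

lemma \<eta>_eq:
  "(\<eta> \<alpha> :: 'k::{comm_ring, comm_monoid_mult, numeral} pseries) m =
    (if comp_of m \<in> Comp (sum_list \<alpha>) \<and> Des (comp_of m) \<subseteq> Des \<alpha>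
     then 2 ^ length (comp_of m) else 0)"
proof -
  let ?S = "{\<beta>. \<beta> \<in> Comp (sum_list \<alpha>) \<and> Des \<beta> \<subseteq> Des \<alpha>}"
  have "\<eta> \<alpha> m = (\<Sum>\<beta>\<in>?S. if comp_of m = \<beta> then 2 ^ length \<beta> else (0 :: 'k))"
    unfolding \<eta>_def by (rule sum.cong) (auto simp: M_eq Comp_def)
  then show ?thesis by (simp add: finite_Comp)
qed

lemma QSym_iff:
  "f \<in> QSym \<longleftrightarrow> (\<exists>d. \<forall>m. f m \<noteq> 0 \<longrightarrow> mono_deg m \<le> d) \<and>
    (\<forall>m m'. comp_of m = comp_of m' \<longrightarrow> f m = f m')"
proof safe
  fix m m' assume f: "f \<in> QSym" and eq: "comp_of m = comp_of m'"
  \<comment> \<open>Every monomial is compared with its packed form, which uses an initial segment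
    of the variables and depends only on \<open>comp_of m\<close>.\<close>
  have "f (mono_of [0..<length (comp_of m)] (comp_of m)) = f m" for m
  proof -
    have "f (mono_of [0..<length (comp_of m)] (comp_of m)) =
        f (mono_of (sorted_list_of_set (Poly_Mapping.keys m)) (comp_of m))"
      using f length_comp_of[of m] strict_sorted_list_of_set unfolding QSym_def by blast
    then show ?thesis by (simp add: mono_of_comp_of)
  qed
  from this[of m] this[of m'] show "f m = f m'" by (simp add: eq)
next
  fix d assume "\<forall>m. f m \<noteq> 0 \<longrightarrow> mono_deg m \<le> d"
    and f: "\<forall>m m'. comp_of m = comp_of m' \<longrightarrow> f m = f m'"
  moreover have "f (mono_of [0..<length \<alpha>] \<alpha>) = f (mono_of is \<alpha>)"
    if "length is = length \<alpha>" "sorted_wrt (<) is" for \<alpha> "is"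
    by (intro f[rule_format]) (simp add: comp_of_mono_of that)
  ultimately show "f \<in> QSym" unfolding QSym_def by blast
qed (unfold QSym_def, blast)

lemma \<eta>_in_QSym: "\<eta> \<alpha> \<in> QSym"
  unfolding QSym_iff
proof (intro conjI exI allI impI)
  fix m assume "\<eta> \<alpha> m \<noteq> (0 :: 'a)"
  then show "mono_deg m \<le> sum_list \<alpha>"
    using comp_of_in_Comp[of m] by (auto simp: \<eta>_eq Comp_def split: if_splits)
qed (simp add: \<eta>_eq)

lemma QSym_sum:
  assumes "finite J" "\<And>i. i \<in> J \<Longrightarrow> f i \<in> QSym"
  shows "(\<lambda>m. \<Sum>i\<in>J. f i m) \<in> QSym"
  using assms by (induction J rule: finite_induct) (simp_all add: QSym_zero QSym_add)

text \<open>The coefficient of \<open>M \<beta>\<close> is the value of \<open>f\<close> at the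
  packed monomial of \<beta>; the degree bound makes the sum finite.\<close>

lemma QSym_expand_M:
  fixes f :: "'k::{comm_ring, comm_monoid_mult} pseries"
  assumes "f \<in> QSym"
  obtains d g where "f = (\<lambda>m. \<Sum>\<beta>\<in>(\<Union>n\<le>d. Comp n). g \<beta> * M \<beta> m)"
proof -
  obtain d where d: "\<And>m. f m \<noteq> 0 \<Longrightarrow> mono_deg m \<le> d"
    and f: "\<And>m m'. comp_of m = comp_of m' \<Longrightarrow> f m = f m'"
    using assms unfolding QSym_iff by blast
  have "f m = (\<Sum>\<beta>\<in>(\<Union>n\<le>d. Comp n). f (mono_of [0..<length \<beta>] \<beta>) * M \<beta> m)" for m
  proof -
    have "(\<Sum>\<beta>\<in>(\<Union>n\<le>d. Comp n). f (mono_of [0..<length \<beta>] \<beta>) * M \<beta> m) =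
        (\<Sum>\<beta>\<in>(\<Union>n\<le>d. Comp n). if comp_of m = \<beta> then f m else 0)"
      by (rule sum.cong)
        (auto simp: M_eq Comp_def comp_of_mono_of_upt intro!: f)
    also have "\<dots> = (if comp_of m \<in> (\<Union>n\<le>d. Comp n) then f m else 0)"
      by (simp add: finite_Comp)
    \<comment> \<open>If \<open>comp_of m\<close> lies outside the index set, then \<open>m\<close>
      has degree above \<open>d\<close> and \<open>f m = 0\<close>.\<close>
    also have "\<dots> = f m"
      using d[of m] comp_of_in_Comp[of m] by auto
    finally show ?thesis ..
  qed
  then show thesis by (intro that[of "\<lambda>\<beta>. f (mono_of [0..<length \<beta>] \<beta>)" d] ext)
qed

subsection \<open>Spans\<close>

lemma span_family_scale:
  "(\<lambda>m. a * f m) \<in> span_family I b" if "f \<in> span_family I b"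
proof -
  from that obtain J c where "f = (\<lambda>m. \<Sum>i\<in>J. c i * b i m)" "finite J" "J \<subseteq> I"
    by (auto simp: span_family_def)
  then have "(\<lambda>m. a * f m) = (\<lambda>m. \<Sum>i\<in>J. (a * c i) * b i m) \<and> finite J \<and> J \<subseteq> I"
    by (simp add: sum_distrib_left mult.assoc)
  then show ?thesis unfolding span_family_def
    by (intro CollectI exI[of _ J] exI[of _ "\<lambda>i. a * c i"])
qed

lemma span_family_add:
  assumes "f \<in> span_family I b" "g \<in> span_family I b"
  shows "(\<lambda>m. f m + g m) \<in> span_family I b"
proof -
  obtain J c K e where f: "f = (\<lambda>m. \<Sum>i\<in>J. c i * b i m)" and J: "finite J" "J \<subseteq> I"
    and g: "g = (\<lambda>m. \<Sum>i\<in>K. e i * b i m)" and K: "finite K" "K \<subseteq> I"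
    using assms by (auto simp: span_family_def)
  \<comment> \<open>Extending the coefficients by zero puts both combinations over the common index
    set \<open>J \<union> K\<close>.\<close>
  have extend: "(\<Sum>i\<in>L. h i * b i m) = (\<Sum>i\<in>J \<union> K. (if i \<in> L then h i else 0) * b i m)"
    if "L \<subseteq> J \<union> K" for L h m
    using that J K by (intro sum.mono_neutral_cong_left) auto
  have "f m + g m =
      (\<Sum>i\<in>J \<union> K. ((if i \<in> J then c i else 0) + (if i \<in> K then e i else 0)) * b i m)" for m
    unfolding f g by (simp add: extend[of J] extend[of K] sum.distrib distrib_right)
  then show ?thesis using J K unfolding span_family_def
    by (intro CollectI exI[of _ "J \<union> K"] exI[of _
      "\<lambda>i. (if i \<in> J then c i else 0) + (if i \<in> K then e i else 0)"]) auto
qed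

lemma span_family_zero: "(\<lambda>m. 0) \<in> span_family I b"
  unfolding span_family_def by (intro CollectI exI[of _ "{}"]) simp

lemma span_family_sum:
  assumes "finite J" "\<And>i. i \<in> J \<Longrightarrow> f i \<in> span_family I b"
  shows "(\<lambda>m. \<Sum>i\<in>J. f i m) \<in> span_family I b"
  using assms
  by (induction J rule: finite_induct) (simp_all add: span_family_zero span_family_add)

lemma span_family_base: "b i \<in> span_family I b" if "i \<in> I"
  unfolding span_family_def
  using that by (intro CollectI exI[of _ "{i}"] exI[of _ "\<lambda>_. 1"]) simp

section \<open>Triangularity and the basis property\<close>

text \<open>Supplies the inverse of the diagonal entry \<open>2 ^ length \<beta>\<close>, both for
  spanning and for independence.\<close>

lemma dvd_one_power:
  fixes x :: "'k::comm_monoid_mult"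
  assumes "x dvd 1"
  obtains v where "v * x ^ n = 1"
proof -
  obtain u where "u * x = 1" using assms by (metis dvd_def mult.commute)
  then have "u ^ n * x ^ n = 1" by (simp flip: power_mult_distrib)
  then show thesis by (rule that)
qed

text \<open>Induction on the number of descents: \<eta> at \<beta> is a unit times
  \<open>M \<beta>\<close> plus terms with strictly smaller descent sets, and can be solved for
  \<open>M \<beta>\<close>.\<close>

lemma M_in_span_\<eta>:
  assumes "(2 :: 'k::{comm_ring, comm_monoid_mult, numeral}) dvd 1" and "\<beta> \<in> Comp n"
  shows "(M \<beta> :: 'k pseries) \<in> span_family (\<Union>n. Comp n) \<eta>"
  using assms(2)
proof (induction "card (Des \<beta>)" arbitrary: \<beta> rule: less_induct)
  case less
  let ?V = "span_family (\<Union>n. Comp n) (\<eta> :: nat list \<Rightarrow> 'k pseries)"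
  let ?S = "{\<gamma> \<in> Comp n. Des \<gamma> \<subset> Des \<beta>}"
  obtain v :: 'k where v: "v * 2 ^ length \<beta> = 1"
    using assms(1) by (rule dvd_one_power)
  \<comment> \<open>By injectivity of \<open>Des\<close> on \<open>Comp n\<close>, only \<beta>
    itself attains equality of descent sets.\<close>
  have S: "{\<gamma>. \<gamma> \<in> Comp (sum_list \<beta>) \<and> Des \<gamma> \<subseteq> Des \<beta>} = insert \<beta> ?S"
    using less.prems inj_onD[OF inj_on_Des[of n]] by (auto simp: Comp_def)
  have fin: "finite ?S" by (simp add: finite_Comp)
  have \<eta>: "\<eta> \<beta> m = 2 ^ length \<beta> * M \<beta> m + (\<Sum>\<gamma>\<in>?S. 2 ^ length \<gamma> * M \<gamma> m)"
    for m :: mono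
    unfolding \<eta>_def S using fin by simp
  have "M \<beta> m = v * \<eta> \<beta> m + (\<Sum>\<gamma>\<in>?S. (- v * 2 ^ length \<gamma>) * M \<gamma> m)" for m
  proof -
    have "v * \<eta> \<beta> m = (v * 2 ^ length \<beta>) * M \<beta> m + (\<Sum>\<gamma>\<in>?S. (v * 2 ^ length \<gamma>) * M \<gamma> m)"
      by (simp add: \<eta> distrib_left sum_distrib_left mult.assoc)
    then show ?thesis by (simp add: v sum_negf)
  qed
  then have M: "M \<beta> = (\<lambda>m. v * \<eta> \<beta> m + (\<Sum>\<gamma>\<in>?S. (- v * 2 ^ length \<gamma>) * M \<gamma> m))"
    by (rule ext)
  have "M \<gamma> \<in> ?V" if "\<gamma> \<in> ?S" for \<gamma>
    using that by (intro less.hyps) (auto intro: psubset_card_mono finite_Des)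
  moreover have "\<eta> \<beta> \<in> ?V" using less.prems by (intro span_family_base) auto
  ultimately show ?case
    unfolding M using fin by (intro span_family_add span_family_scale span_family_sum)
qed

text \<open>Among the indices with nonzero coefficient, one with maximal descent set is chosen; the
  packed monomial of that \<beta> isolates its coefficient, up to a unit.\<close>

lemma lin_indep_\<eta>:
  assumes "(2 :: 'k::{comm_ring, comm_monoid_mult, numeral}) dvd 1"
  shows "lin_indep_family (\<Union>n. Comp n) (\<eta> :: nat list \<Rightarrow> 'k pseries)"
  unfolding lin_indep_family_def
proof (intro allI impI, rule ccontr)
  fix J and c :: "nat list \<Rightarrow> 'k"
  assume J: "finite J" "J \<subseteq> (\<Union>n. Comp n)"
    and zero: "(\<lambda>m. \<Sum>i\<in>J. c i * \<eta> i m) = (\<lambda>m. 0)"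
    and "\<not> (\<forall>i\<in>J. c i = 0)"
  then have "finite (Des ` {i\<in>J. c i \<noteq> 0})" "Des ` {i\<in>J. c i \<noteq> 0} \<noteq> {}" by auto
  from finite_has_maximal[OF this] obtain \<beta> where \<beta>: "\<beta> \<in> J" "c \<beta> \<noteq> 0"
    and max: "\<And>i. i \<in> J \<Longrightarrow> c i \<noteq> 0 \<Longrightarrow> Des \<beta> \<subseteq> Des i \<Longrightarrow> Des i = Des \<beta>"
    by auto
  have pos: "\<forall>a\<in>set i. 0 < a" "i \<in> Comp (sum_list i)" if "i \<in> J" for i
    using that J by (auto simp: Comp_def)
  let ?m = "mono_of [0..<length \<beta>] \<beta>"
  \<comment> \<open>A nonzero term needs \<open>i\<close> to have the same size as \<beta> and
    \<open>Des \<beta> \<subseteq> Des i\<close>. Maximality makes the descent sets equal, and equal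
    size then gives \<open>i = \<beta>\<close>.\<close>
  have "c i * \<eta> i ?m = (if i = \<beta> then c \<beta> * 2 ^ length \<beta> else 0)" if i: "i \<in> J" for i
  proof (cases "\<beta> \<in> Comp (sum_list i) \<and> Des \<beta> \<subseteq> Des i \<and> c i \<noteq> 0")
    case True
    then have "i = \<beta>"
      using max[OF i] pos[OF i] by (intro inj_onD[OF inj_on_Des]) auto
    then show ?thesis using pos[OF i] by (simp add: \<eta>_eq comp_of_mono_of_upt)
  next
    case False
    then show ?thesis using pos[OF \<open>\<beta> \<in> J\<close>] \<beta> by (auto simp: \<eta>_eq comp_of_mono_of_upt)
  qed
  then have "(\<Sum>i\<in>J. c i * \<eta> i ?m) = c \<beta> * 2 ^ length \<beta>"
    using J \<beta> by simp
  moreover have "(\<Sum>i\<in>J. c i * \<eta> i ?m) = 0" using zero by (rule fun_cong)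
  ultimately have 0: "c \<beta> * 2 ^ length \<beta> = 0" by simp
  obtain v :: 'k where v: "v * 2 ^ length \<beta> = 1"
    using assms by (rule dvd_one_power)
  have "c \<beta> = c \<beta> * (v * 2 ^ length \<beta>)" by (simp add: v)
  also have "\<dots> = v * (c \<beta> * 2 ^ length \<beta>)" by (rule mult.left_commute)
  also have "\<dots> = 0" by (simp add: 0)
  finally show False using \<beta> by simp
qed

theorem theorem1:
  assumes "(2 :: 'k::{comm_ring, comm_monoid_mult, numeral}) dvd 1"
  shows "basis_family (\<Union>n. Comp n) (\<eta> :: nat list \<Rightarrow> 'k pseries) QSym"
  unfolding basis_family_def
proof (rule conjI[OF lin_indep_\<eta>[OF assms]], rule equalityI; rule subsetI)
  fix f assume "f \<in> span_family (\<Union>n. Comp n) (\<eta> :: nat list \<Rightarrow> 'k pseries)"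
  then obtain J c where f: "f = (\<lambda>m. \<Sum>i\<in>J. c i * \<eta> i m)" and "finite J"
    by (auto simp: span_family_def)
  show "f \<in> QSym"
    unfolding f by (intro QSym_sum QSym_scale \<eta>_in_QSym \<open>finite J\<close>)
next
  fix f :: "'k pseries" assume "f \<in> QSym"
  then obtain d g where f: "f = (\<lambda>m. \<Sum>\<beta>\<in>(\<Union>n\<le>d. Comp n). g \<beta> * M \<beta> m)"
    by (rule QSym_expand_M)
  show "f \<in> span_family (\<Union>n. Comp n) \<eta>"
    unfolding f by (intro span_family_sum span_family_scale)
      (auto simp: finite_Comp intro: M_in_span_\<eta>[OF assms])
qed

end
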